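(* For every $\delta>0$: (a) there is a set $A\subset\mathbb{R}^2$ that has property (v) with respect to $\delta$ for $j=1$ but does not have weak locally finite $\mathcal{H}^1$ measure; (b) there is a set $A\subset\mathbb{R}^2$ that has property (ii) with respect to $\delta$ for $j=1$ and whose Hausdorff dimension is strictly greater than $1$; (c) there is a set $A\subset\mathbb{R}^2$ that has property (ii) with respect to $\delta$ for $j=1$ but does not have weak locally finite $\mathcal{H}^1$ measure.
   Context: $\mathcal{H}^1$ is one-dimensional Hausdorff measure, $B_\rho(y)$ the open ball, and $L^s:=\{x:|x-z|<s\text{ for some }z\in L\}$ for an affine space $L$. Property (ii) (weak $j$-dimensional $\delta$-approximation property with local $\rho_y$-uniformity) for $A\subset\mathbb{R}^n$ and $\delta>0$: for every $y\in A$ there is $\rho_y>0$ such that for all $\rho\in(0,\rho_y]$ and all $x\in B_{\rho_y}(y)$ there is a $j$-dimensional affine space $L_{x,\rho}$ with $B_\rho(x)\cap A\subset L_{x,\rho}^{\delta\rho}$. Property (v) (the $\rho_0$-uniform weak $j$-dimensional $\delta$-approximation property) for $A\subset\mathbb{R}^n$ and $\delta>0$: there is $\rho_0>0$ such that $A$ is contained in some ball of radius $\rho_0$ and, for every $y\in A$ and every $\rho\in(0,\rho_0]$, there is a $j$-dimensional affine space $L_{y,\rho}$ containing $y$ with $B_\rho(y)\cap A\subset L_{y,\rho}^{\delta\rho}$. A set $A$ has weak locally finite $\mathcal{H}^1$ measure if for each $y\in A$ there is $\rho_y>0$ with $\mathcal{H}^1(B_{\rho_y}(y)\cap A)<\infty$.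 *)

theory Defs
  imports "HOL-Analysis.Analysis"
begin

text \<open>
  Hausdorff measures are outer measures on all subsets, with values in \<^typ>\<open>ennreal\<close>.
  The normalising factor \<open>\<omega>\<^sub>s / 2\<^sup>s\<close> (\<open>\<omega>\<^sub>s\<close> the volume of the unit \<open>s\<close>-ball) is omitted:
  it equals 1 for \<open>s = 1\<close> and is irrelevant for the Hausdorff dimension.
\<close>

text \<open>
  The gauge is \<open>(diam U)\<^sup>s\<close> with \<open>0\<^sup>0 = 1\<close> and \<open>diam {} ^ 0 = 0\<close>; the case distinction is needed
  because \<open>0 powr 0 = 0\<close>.
\<close>

definition hausdorff_gauge :: "real \<Rightarrow> 'a::metric_space set \<Rightarrow> ennreal" where
  "hausdorff_gauge s U =
     (if U = {} then 0 else if s = 0 then 1 else ennreal (diameter U powr s))"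

text \<open>
  Boundedness is required explicitly because \<^const>\<open>diameter\<close> is unspecified on unbounded sets.
  Finite covers are included, since members of the sequence may be empty.
\<close>

definition hausdorff_covers :: "real \<Rightarrow> 'a::metric_space set \<Rightarrow> (nat \<Rightarrow> 'a set) set" where
  "hausdorff_covers d A =
     {U. A \<subseteq> (\<Union>i. U i) \<and> (\<forall>i. bounded (U i) \<and> diameter (U i) \<le> d)}"

definition hausdorff_premeasure :: "real \<Rightarrow> real \<Rightarrow> 'a::metric_space set \<Rightarrow> ennreal" where
  "hausdorff_premeasure s d A =
     (INF U\<in>hausdorff_covers d A. \<Sum>i. hausdorff_gauge s (U i))"

definition hausdorff_measure :: "real \<Rightarrow> 'a::metric_space set \<Rightarrow> ennreal" where
  "hausdorff_measure s A = (SUP d\<in>{0<..}. hausdorff_premeasure s d A)"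

definition hausdorff_dim :: "'a::metric_space set \<Rightarrow> ennreal" where
  "hausdorff_dim A = Inf {ennreal s | s. 0 \<le> s \<and> hausdorff_measure s A = 0}"

definition open_nbhd :: "'a::real_normed_vector set \<Rightarrow> real \<Rightarrow> 'a set" where
  "open_nbhd L s = {x. \<exists>z\<in>L. norm (x - z) < s}"

definition affine_space_of_dim :: "nat \<Rightarrow> 'a::euclidean_space set \<Rightarrow> bool" where
  "affine_space_of_dim j L \<longleftrightarrow> affine L \<and> aff_dim L = int j"

text \<open>Property (ii): the centre \<open>x\<close> need not belong to \<open>A\<close>, nor to the affine space.\<close>

definition weak_approx_locally_uniform ::
    "nat \<Rightarrow> real \<Rightarrow> 'a::euclidean_space set \<Rightarrow> bool" where
  "weak_approx_locally_uniform j \<delta> A \<longleftrightarrow>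
     (\<forall>y\<in>A. \<exists>\<rho>\<^sub>y>0. \<forall>\<rho>. 0 < \<rho> \<and> \<rho> \<le> \<rho>\<^sub>y \<longrightarrow>
        (\<forall>x\<in>ball y \<rho>\<^sub>y. \<exists>L. affine_space_of_dim j L \<and>
           ball x \<rho> \<inter> A \<subseteq> open_nbhd L (\<delta> * \<rho>)))"

text \<open>Property (v): the ball of radius \<open>\<rho>\<^sub>0\<close> containing \<open>A\<close> may have any centre.\<close>

definition weak_approx_uniform ::
    "nat \<Rightarrow> real \<Rightarrow> 'a::euclidean_space set \<Rightarrow> bool" where
  "weak_approx_uniform j \<delta> A \<longleftrightarrow>
     (\<exists>\<rho>\<^sub>0>0. (\<exists>c. A \<subseteq> ball c \<rho>\<^sub>0) \<and>
        (\<forall>y\<in>A. \<forall>\<rho>. 0 < \<rho> \<and> \<rho> \<le> \<rho>\<^sub>0 \<longrightarrow>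
           (\<exists>L. affine_space_of_dim j L \<and> y \<in> L \<and>
              ball y \<rho> \<inter> A \<subseteq> open_nbhd L (\<delta> * \<rho>))))"

definition weak_locally_finite_H1 :: "'a::metric_space set \<Rightarrow> bool" where
  "weak_locally_finite_H1 A \<longleftrightarrow>
     (\<forall>y\<in>A. \<exists>\<rho>\<^sub>y>0. hausdorff_measure 1 (ball y \<rho>\<^sub>y \<inter> A) < \<infinity>)"

end

theory Submission imports Defs begin

text \<open>
  All three parts are witnessed by one generalised Koch curve with a small angle \<open>\<theta>\<close>. Each level-\<open>n\<close>
  segment \<open>v\<close> is replaced by two segments of equal length making angles \<open>\<plusminus>\<theta>\<close> with \<open>v\<close>, the side of
  the bump alternating with \<open>n\<close>. The alternation keeps the angle between adjacent segments of the
  same level at most \<open>4\<theta>\<close>, so on every dyadic parameter interval the curve is affine up to an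
  error \<open>O(\<theta>)\<close> relative to its size there. This makes it \<open>O(\<theta>)\<close>-flat in every ball
  centred on it. Segments shrink by the factor \<open>1 / (2 cos \<theta>) > 1/2\<close>, so the parameter is a Hoelder
  function of exponent \<open>s > 1\<close> of the point. Pulling covers back to the line then bounds the
  Hausdorff premeasures below: the dimension is at least \<open>s\<close>, and every arc has infinite length.
\<close>

section \<open>Two elementary facts: a discrete threshold and chords of the unit circle\<close>

lemma nat_last_before_failure: "Q 0 \<Longrightarrow> \<not> Q m \<Longrightarrow> \<exists>n. Q n \<and> \<not> Q (Suc n)"
  by (induction m) auto

text \<open>The chord has length \<open>2 * \<bar>sin ((a - b) / 2)\<bar>\<close>, at most the arc.
  This turns angles between segments into distances.\<close>

lemma norm_cis_diff_le: "cmod (cis a - cis b) \<le> \<bar>a - b\<bar>"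
proof -
  have "(cmod (cis a - cis b))\<^sup>2 = (cos a - cos b)\<^sup>2 + (sin a - sin b)\<^sup>2"
    by (simp add: cmod_power2)
  also have "\<dots> = 2 - 2 * cos (a - b)"
    using sin_cos_squared_add[of a] sin_cos_squared_add[of b]
    by (simp add: cos_diff power2_eq_square algebra_simps)
  also have "\<dots> = (2 * sin ((a - b) / 2))\<^sup>2"
    using cos_double_sin[of "(a - b) / 2"] by (simp add: power_mult_distrib del: right_diff_distrib_numeral)
      (simp add: algebra_simps)
  also have "\<dots> \<le> (a - b)\<^sup>2"
  proof -
    have "\<bar>2 * sin ((a - b) / 2)\<bar> \<le> \<bar>a - b\<bar>"
      using abs_sin_x_le_abs_x[of "(a - b) / 2"] by simp
    then show ?thesis by (simp only: abs_le_square_iff)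
  qed
  finally show ?thesis
    by (metis abs_le_square_iff abs_norm_cancel)
qed

section \<open>Lower bounds for Hausdorff measures of images with a Hoelder inverse\<close>

lemma hausdorff_premeasure_mono:
  "A \<subseteq> B \<Longrightarrow> hausdorff_premeasure s d A \<le> hausdorff_premeasure s d B"
  unfolding hausdorff_premeasure_def hausdorff_covers_def
  by (rule INF_superset_mono) auto

lemma hausdorff_premeasure_le_measure:
  "d > 0 \<Longrightarrow> hausdorff_premeasure s d A \<le> hausdorff_measure s A"
  unfolding hausdorff_measure_def by (rule SUP_upper) simp

lemma hausdorff_measure_mono:
  "A \<subseteq> B \<Longrightarrow> hausdorff_measure s A \<le> hausdorff_measure s B"
  unfolding hausdorff_measure_def by (intro SUP_mono) (auto intro: hausdorff_premeasure_mono)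

text \<open>Mass distribution by Lebesgue measure on the parameters: those landing in
  \<open>U i\<close> lie in an interval of length \<open>2 * K * diameter (U i) powr s\<close>, and
  these intervals together cover \<open>{0..c}\<close>.\<close>

lemma hausdorff_premeasure_ge:
  fixes F :: "real \<Rightarrow> 'a::metric_space"
  assumes "c > 0" "K > 0" "0 \<le> t" "t < s" "d > 0"
    and hoelder: "\<And>x y. x \<in> {0..c} \<Longrightarrow> y \<in> {0..c} \<Longrightarrow> \<bar>x - y\<bar> \<le> K * dist (F x) (F y) powr s"
  shows "ennreal (c / (2 * K) * d powr (t - s)) \<le> hausdorff_premeasure t d (F ` {0..c})"
  unfolding hausdorff_premeasure_def
proof (rule INF_greatest)
  fix U assume "U \<in> hausdorff_covers d (F ` {0..c})"
  then have cov: "F ` {0..c} \<subseteq> (\<Union>i. U i)" and bd: "\<And>i. bounded (U i)"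
    and di: "\<And>i. diameter (U i) \<le> d"
    by (auto simp: hausdorff_covers_def)
  \<comment> \<open>Diameters are at most \<open>d\<close>, so
    \<open>2 * K * diam powr s \<le> M * diam powr t\<close>: lowering the exponent from
    \<open>s\<close> to \<open>t\<close> costs the factor \<open>d powr (s - t)\<close>.\<close>
  define M where "M = 2 * K * d powr (s - t)"
  have "M > 0" using assms by (simp add: M_def)
  \<comment> \<open>The parameter set of \<open>U i\<close> may fail to be measurable, so an
    interval around one of its points replaces it.\<close>
  have "\<exists>I. I \<in> sets lborel \<and> {x \<in> {0..c}. F x \<in> U i} \<subseteq> I \<and>
      emeasure lborel I \<le> ennreal M * hausdorff_gauge t (U i)" for i
  proof (cases "\<exists>x\<in>{0..c}. F x \<in> U i")
    case False
    then show ?thesis by (intro exI[of _ "{}"]) auto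
  next
    case True
    then obtain x0 where x0: "x0 \<in> {0..c}" "F x0 \<in> U i" by auto
    define r where "r = K * diameter (U i) powr s"
    have r0: "r \<ge> 0" using assms by (simp add: r_def)
    have "x \<in> {x0 - r..x0 + r}" if "x \<in> {0..c}" "F x \<in> U i" for x
    proof -
      have "\<bar>x - x0\<bar> \<le> K * dist (F x) (F x0) powr s" using hoelder that x0 by blast
      also have "\<dots> \<le> r" unfolding r_def
        using diameter_bounded_bound[OF bd that(2) x0(2)] assms
        by (intro mult_left_mono powr_mono2) auto
      finally show ?thesis by auto
    qed
    moreover have "emeasure lborel {x0 - r..x0 + r} \<le> ennreal M * hausdorff_gauge t (U i)"
    proof -
      have dp: "diameter (U i) \<ge> 0" using bd diameter_ge_0 by blast
      have "2 * r \<le> M * (if t = 0 then 1 else diameter (U i) powr t)"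
      \<comment> \<open>For \<open>t = 0\<close> the gauge of a nonempty set is 1, whereas
        \<open>diameter (U i) powr 0\<close> is 0 if the diameter vanishes.\<close>
      proof (cases "t = 0")
        case True
        have "diameter (U i) powr s \<le> d powr s"
          using di dp assms by (intro powr_mono2) auto
        then show ?thesis using True assms by (simp add: r_def M_def)
      next
        case False
        have "diameter (U i) powr s = diameter (U i) powr (s - t) * diameter (U i) powr t"
          by (simp flip: powr_add)
        also have "\<dots> \<le> d powr (s - t) * diameter (U i) powr t"
          using di dp assms by (intro mult_right_mono powr_mono2) auto
        finally show ?thesis using False assms by (simp add: r_def M_def)
      qed
      then have "ennreal (2 * r) \<le> ennreal (M * (if t = 0 then 1 else diameter (U i) powr t))"
        by (rule ennreal_leI)
      also have "\<dots> = ennreal M * hausdorff_gauge t (U i)"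
        using x0 \<open>M > 0\<close> by (auto simp: hausdorff_gauge_def ennreal_mult)
      finally show ?thesis using r0 by simp
    qed
    ultimately show ?thesis by (intro exI[of _ "{x0 - r..x0 + r}"]) auto
  qed
  then have "\<exists>I. \<forall>i. I i \<in> sets lborel \<and> {x \<in> {0..c}. F x \<in> U i} \<subseteq> I i \<and>
      emeasure lborel (I i) \<le> ennreal M * hausdorff_gauge t (U i)"
    by (intro choice allI)
  then obtain I where "\<forall>i. I i \<in> sets lborel \<and> {x \<in> {0..c}. F x \<in> U i} \<subseteq> I i \<and>
      emeasure lborel (I i) \<le> ennreal M * hausdorff_gauge t (U i)" ..
  then have I: "I i \<in> sets lborel" "{x \<in> {0..c}. F x \<in> U i} \<subseteq> I i"
    "emeasure lborel (I i) \<le> ennreal M * hausdorff_gauge t (U i)" for i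
    by simp_all
  have sub: "{0..c} \<subseteq> (\<Union>i. I i)"
  proof
    fix x assume x: "x \<in> {0..c}"
    then have "F x \<in> (\<Union>i. U i)" using cov by blast
    then obtain i where "F x \<in> U i" by blast
    with x have "x \<in> I i" using I(2)[of i] by auto
    then show "x \<in> (\<Union>i. I i)" by auto
  qed
  have "ennreal c = emeasure lborel {0..c}" using assms by simp
  also have "\<dots> \<le> emeasure lborel (\<Union>i. I i)"
    using sub I(1) by (intro emeasure_mono) auto
  also have "\<dots> \<le> (\<Sum>i. emeasure lborel (I i))"
    using I(1) by (intro emeasure_subadditive_countably) auto
  also have "\<dots> \<le> (\<Sum>i. ennreal M * hausdorff_gauge t (U i))"
    by (intro suminf_le I(3)) auto
  also have "\<dots> = ennreal M * (\<Sum>i. hausdorff_gauge t (U i))"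
    by simp
  finally have *: "ennreal c \<le> ennreal M * (\<Sum>i. hausdorff_gauge t (U i))" .
  have "ennreal (c / (2 * K) * d powr (t - s)) = ennreal (1 / M) * ennreal c"
    using assms \<open>M > 0\<close>
    by (simp add: M_def powr_diff field_simps flip: ennreal_mult)
  also have "\<dots> \<le> ennreal (1 / M) * (ennreal M * (\<Sum>i. hausdorff_gauge t (U i)))"
    using * by (intro mult_left_mono) auto
  also have "\<dots> = (\<Sum>i. hausdorff_gauge t (U i))"
    using \<open>M > 0\<close> by (simp add: mult.assoc[symmetric] ennreal_mult[symmetric])
  finally show "ennreal (c / (2 * K) * d powr (t - s)) \<le> (\<Sum>i. hausdorff_gauge t (U i))" .
qed

text \<open>For every \<open>t < s\<close> the premeasure bound at the single scale 1 is already
  positive, so such a \<open>t\<close> cannot enter the infimum.\<close>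

lemma hausdorff_dim_ge:
  fixes F :: "real \<Rightarrow> 'a::metric_space"
  assumes "c > 0" "K > 0"
    and "\<And>x y. x \<in> {0..c} \<Longrightarrow> y \<in> {0..c} \<Longrightarrow> \<bar>x - y\<bar> \<le> K * dist (F x) (F y) powr s"
  shows "ennreal s \<le> hausdorff_dim (F ` {0..c})"
  unfolding hausdorff_dim_def
proof (rule Inf_greatest, clarify)
  fix t :: real assume t: "0 \<le> t" "hausdorff_measure t (F ` {0..c}) = 0"
  show "ennreal s \<le> ennreal t"
  proof (rule ccontr)
    assume "\<not> ?thesis"
    then have "t < s" using ennreal_leI not_le by blast
    have "ennreal (c / (2 * K) * 1 powr (t - s)) \<le> hausdorff_premeasure t 1 (F ` {0..c})"
      using assms t \<open>t < s\<close> by (intro hausdorff_premeasure_ge) auto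
    also have "\<dots> \<le> hausdorff_measure t (F ` {0..c})"
      by (rule hausdorff_premeasure_le_measure) simp
    finally show False using assms t by (simp add: ennreal_eq_0_iff divide_le_0_iff)
  qed
qed

text \<open>Since \<open>t - s\<close> is negative, the premeasure bound tends to infinity as
  \<open>d\<close> tends to 0.\<close>

lemma hausdorff_measure_infinite:
  fixes F :: "real \<Rightarrow> 'a::metric_space"
  assumes "c > 0" "K > 0" "0 \<le> t" "t < s"
    and "\<And>x y. x \<in> {0..c} \<Longrightarrow> y \<in> {0..c} \<Longrightarrow> \<bar>x - y\<bar> \<le> K * dist (F x) (F y) powr s"
  shows "hausdorff_measure t (F ` {0..c}) = \<infinity>"
proof -
  have "ennreal b \<le> hausdorff_measure t (F ` {0..c})" if "b > 0" for b
  proof -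
    \<comment> \<open>The scale at which the premeasure bound equals \<open>b\<close>.\<close>
    define d where "d = (b * (2 * K) / c) powr (1 / (t - s))"
    have "d > 0" using assms that by (simp add: d_def)
    have "d powr (t - s) = b * (2 * K) / c"
      using assms that by (simp add: d_def powr_powr)
    then have "ennreal b = ennreal (c / (2 * K) * d powr (t - s))"
      using assms by simp
    also have "\<dots> \<le> hausdorff_premeasure t d (F ` {0..c})"
      using assms \<open>d > 0\<close> by (intro hausdorff_premeasure_ge) auto
    also have "\<dots> \<le> hausdorff_measure t (F ` {0..c})"
      using \<open>d > 0\<close> by (rule hausdorff_premeasure_le_measure)
    finally show ?thesis .
  qed
  note * = this
  show ?thesis
  proof (cases "hausdorff_measure t (F ` {0..c})")
    case (real r)
    then have "ennreal (r + 1) \<le> ennreal r" using *[of "r + 1"] by simp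
    then show ?thesis using real by simp
  qed simp
qed

section \<open>The alternating Koch construction: directions, segments and vertices\<close>

locale koch =
  fixes \<theta> :: real
  assumes theta_pos: "0 < \<theta>" and theta_le: "\<theta> \<le> 1 / 200"
begin

definition ratio :: real where "ratio = 1 / (2 * cos \<theta>)"

lemma cos_theta: "199 / 200 \<le> cos \<theta>" "cos \<theta> < 1"
proof -
  have "\<bar>Re (cis \<theta> - cis 0)\<bar> \<le> \<theta>"
    using abs_Re_le_cmod[of "cis \<theta> - cis 0"] norm_cis_diff_le[of \<theta> 0] theta_pos by simp
  then show "199 / 200 \<le> cos \<theta>" using theta_le by simp
  show "cos \<theta> < 1"
    using cos_monotone_0_pi[of 0 \<theta>] theta_pos theta_le pi_gt3 by simp
qed

lemma ratio_bounds: "1 / 2 < ratio" "ratio \<le> 3 / 4" "0 < ratio"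
  using cos_theta by (auto simp: ratio_def field_simps)

text \<open>Direction of the \<open>k\<close>-th level-\<open>n\<close> segment, in units of \<open>(-1)^n \<theta>\<close>.\<close>
fun dir :: "nat \<Rightarrow> int \<Rightarrow> int" where
  "dir 0 k = 0"
| "dir (Suc n) k = (if even k then 1 else -1) - dir n (k div 2)"

text \<open>Siblings differ by -2. Across a parent vertex a difference \<open>d\<close> becomes
  \<open>2 - d\<close>, a map preserving the set \<open>{-2, 0, 2, 4}\<close>. With all bumps on one
  side it would become \<open>2 + d\<close> and grow without bound.\<close>

lemma dir_adjacent: "dir n (k + 1) - dir n k \<in> {-2, 0, 2, 4}"
proof (induction n arbitrary: k)
  case (Suc n)
  show ?case
  proof (cases "even k")
    case True
    then show ?thesis by (auto elim!: evenE)
  next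
    case False
    then obtain j where "k = 2 * j + 1" by (rule oddE)
    moreover have "(2 * j + 2) div 2 = j + 1" by simp
    ultimately have "dir (Suc n) (k + 1) - dir (Suc n) k = 2 - (dir n (j + 1) - dir n j)"
      by (simp add: add.commute)
    then show ?thesis using Suc.IH[of j] by auto
  qed
qed simp

definition seg :: "nat \<Rightarrow> int \<Rightarrow> complex" where
  "seg n k = of_real (ratio ^ n) * cis (\<theta> * (-1) ^ n * of_int (dir n k))"

lemma norm_seg: "cmod (seg n k) = ratio ^ n"
  using ratio_bounds by (simp add: seg_def norm_mult norm_power)

lemma norm_seg_diff: "cmod (seg n k - seg n l) \<le> ratio ^ n * (\<theta> * \<bar>of_int (dir n k - dir n l)\<bar>)"
proof -
  have "cmod (seg n k - seg n l) = ratio ^ n *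
      cmod (cis (\<theta> * (-1) ^ n * of_int (dir n k)) - cis (\<theta> * (-1) ^ n * of_int (dir n l)))"
    unfolding seg_def using ratio_bounds
    by (simp add: norm_mult norm_power flip: right_diff_distrib)
  also have "\<dots> \<le> ratio ^ n * \<bar>\<theta> * (-1) ^ n * of_int (dir n k) - \<theta> * (-1) ^ n * of_int (dir n l)\<bar>"
    using ratio_bounds by (intro mult_left_mono norm_cis_diff_le) auto
  also have "\<bar>\<theta> * (-1) ^ n * of_int (dir n k) - \<theta> * (-1) ^ n * of_int (dir n l)\<bar> =
      \<theta> * \<bar>of_int (dir n k - dir n l)\<bar>"
    using theta_pos by (simp add: abs_mult power_abs flip: right_diff_distrib)
  finally show ?thesis .
qed

lemma norm_seg_adjacent: "cmod (seg n (k + 1) - seg n k) \<le> 4 * \<theta> * ratio ^ n"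
proof -
  have "\<bar>dir n (k + 1) - dir n k\<bar> \<le> 4" using dir_adjacent[of n k] by auto
  then have "\<bar>of_int (dir n (k + 1) - dir n k)\<bar> \<le> (4 :: real)" by linarith
  then have "ratio ^ n * (\<theta> * \<bar>of_int (dir n (k + 1) - dir n k)\<bar>) \<le> ratio ^ n * (\<theta> * 4)"
    using ratio_bounds theta_pos by (intro mult_left_mono) auto
  then show ?thesis using norm_seg_diff[of n "k + 1" k] by (simp add: mult_ac)
qed

text \<open>The children turn by opposite angles \<theta> from the parent: their transverse parts
  cancel, and their parts along it add up to \<open>2 * cos \<theta> * ratio = 1\<close> times the
  parent.\<close>

lemma seg_split: "seg (Suc n) (2 * k) + seg (Suc n) (2 * k + 1) = seg n k"
proof -
  define b where "b = \<theta> * (-1) ^ n * of_int (dir n k)"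
  define e where "e = \<theta> * (-1) ^ n"
  have "\<theta> * (-1) ^ Suc n * of_int (dir (Suc n) (2 * k)) = b - e"
    "\<theta> * (-1) ^ Suc n * of_int (dir (Suc n) (2 * k + 1)) = b + e"
    by (simp_all add: b_def e_def algebra_simps)
  then have "seg (Suc n) (2 * k) = of_real (ratio ^ Suc n) * cis (b - e)"
    "seg (Suc n) (2 * k + 1) = of_real (ratio ^ Suc n) * cis (b + e)"
    unfolding seg_def by (simp_all only:)
  moreover have "cis (b - e) + cis (b + e) = of_real (2 * cos \<theta>) * cis b"
  proof -
    have "cos e = cos \<theta>" by (cases "even n") (simp_all add: e_def)
    then show ?thesis by (simp add: complex_eq_iff cos_add cos_diff sin_add sin_diff)
  qed
  ultimately have "seg (Suc n) (2 * k) + seg (Suc n) (2 * k + 1) =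
      of_real (ratio ^ Suc n) * (of_real (2 * cos \<theta>) * cis b)"
    by (simp only: flip: distrib_left)
  also have "\<dots> = of_real (ratio ^ n * (ratio * (2 * cos \<theta>))) * cis b" by simp
  also have "ratio * (2 * cos \<theta>) = 1" using cos_theta by (simp add: ratio_def)
  finally show ?thesis by (simp add: seg_def b_def)
qed

text \<open>Indices run over all integers, so the curve is defined on the whole real line; intervals
  centred at a parameter near 0 may then reach below 0.\<close>

fun vertex :: "nat \<Rightarrow> int \<Rightarrow> complex" where
  "vertex 0 k = of_int k"
| "vertex (Suc n) k = vertex n (k div 2) + (if even k then 0 else seg (Suc n) (k - 1))"

lemma vertex_succ: "vertex n (k + 1) = vertex n k + seg n k"
proof (induction n arbitrary: k)
  case 0
  show ?case by (simp add: seg_def)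
next
  case (Suc n)
  show ?case
  proof (cases "even k")
    case True
    then show ?thesis by (auto elim!: evenE)
  next
    case False
    then obtain j where k: "k = 2 * j + 1" by (rule oddE)
    have "(2 * j + 2) div 2 = j + 1" by simp
    then show ?thesis using Suc.IH[of j] seg_split[of n j] k by (simp add: add_ac)
  qed
qed

section \<open>Polygonal approximations and their limit curve\<close>

definition polyg :: "nat \<Rightarrow> real \<Rightarrow> complex" where
  "polyg n x = vertex n \<lfloor>2 ^ n * x\<rfloor> + seg n \<lfloor>2 ^ n * x\<rfloor> * of_real (frac (2 ^ n * x))"

text \<open>Refinement moves a point by a tent function of height 1/2 times the difference
  \<open>D\<close> of the two child segments, whose directions differ by the angle
  2\<theta>.\<close>

lemma polyg_step: "cmod (polyg (Suc n) x - polyg n x) \<le> \<theta> * ratio ^ n"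
proof -
  define k where "k = \<lfloor>2 ^ n * x\<rfloor>"
  define s where "s = frac (2 ^ n * x)"
  define D where "D = seg (Suc n) (2 * k) - seg (Suc n) (2 * k + 1)"
  have s: "0 \<le> s" "s < 1" by (simp_all add: s_def frac_lt_1)
  have x: "2 ^ n * x = of_int k + s" by (simp add: k_def s_def frac_def)
  have p0: "polyg n x = vertex n k + (seg (Suc n) (2 * k) + seg (Suc n) (2 * k + 1)) * of_real s"
    unfolding polyg_def seg_split by (simp add: k_def s_def)
  have D: "cmod D \<le> ratio ^ Suc n * (\<theta> * 2)"
    unfolding D_def using norm_seg_diff[of "Suc n" "2 * k" "2 * k + 1"] by simp
  have "\<exists>r. 0 \<le> r \<and> r \<le> 1 / 2 \<and> polyg (Suc n) x - polyg n x = of_real r * D"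
  proof (cases "s < 1 / 2")
    case True
    have fl: "\<lfloor>2 ^ Suc n * x\<rfloor> = 2 * k" using x s True by (simp add: floor_eq_iff)
    then have fr: "frac (2 ^ Suc n * x) = 2 * s" using x by (simp add: frac_def)
    have "polyg (Suc n) x - polyg n x = of_real s * D"
      unfolding polyg_def[of "Suc n"] D_def fl fr p0 by (simp add: algebra_simps)
    then show ?thesis using s True by auto
  next
    case False
    have fl: "\<lfloor>2 ^ Suc n * x\<rfloor> = 2 * k + 1" using x s False by (simp add: floor_eq_iff)
    then have fr: "frac (2 ^ Suc n * x) = 2 * s - 1" using x by (simp add: frac_def)
    have "polyg (Suc n) x - polyg n x = of_real (1 - s) * D"
      unfolding polyg_def[of "Suc n"] D_def fl fr p0 by (simp add: algebra_simps)
    then show ?thesis using s False by (intro exI[of _ "1 - s"]) auto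
  qed
  then obtain r where r: "0 \<le> r" "r \<le> 1 / 2" "polyg (Suc n) x - polyg n x = of_real r * D"
    by blast
  then have "cmod (polyg (Suc n) x - polyg n x) = r * cmod D" by (simp add: norm_mult)
  also have "\<dots> \<le> 1 / 2 * (ratio ^ Suc n * (\<theta> * 2))"
    using r D by (intro mult_mono) auto
  also have "\<dots> = ratio * (\<theta> * ratio ^ n)" by simp
  also have "\<dots> \<le> 1 * (\<theta> * ratio ^ n)"
    using ratio_bounds theta_pos by (intro mult_right_mono) auto
  finally show ?thesis by simp
qed

definition curve :: "real \<Rightarrow> complex" where
  "curve x = lim (\<lambda>n. polyg n x)"

text \<open>The constant 4 is \<open>1 / (1 - 3 / 4)\<close>, from the geometric series with
  \<open>ratio \<le> 3 / 4\<close>. The factor \<open>1 - ratio ^ m\<close> lets the induction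
  close.\<close>

lemma polyg_tail: "cmod (polyg (n + m) x - polyg n x) \<le> 4 * \<theta> * ratio ^ n * (1 - ratio ^ m)"
proof (induction m)
  case (Suc m)
  have "cmod (polyg (n + Suc m) x - polyg n x) \<le>
      cmod (polyg (Suc (n + m)) x - polyg (n + m) x) + cmod (polyg (n + m) x - polyg n x)"
    by (rule order_trans[OF _ norm_triangle_ineq]) simp
  also have "\<dots> \<le> \<theta> * ratio ^ (n + m) + 4 * \<theta> * ratio ^ n * (1 - ratio ^ m)"
    by (intro add_mono polyg_step Suc.IH)
  also have "\<dots> = 4 * \<theta> * ratio ^ n * (1 - ratio ^ m * (3 / 4))"
    by (simp add: power_add algebra_simps)
  also have "\<dots> \<le> 4 * \<theta> * ratio ^ n * (1 - ratio ^ Suc m)"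
    using ratio_bounds theta_pos by (intro mult_left_mono) auto
  finally show ?case .
qed simp

lemma polyg_tendsto: "(\<lambda>n. polyg n x) \<longlonglongrightarrow> curve x"
proof -
  have "summable (\<lambda>n. polyg (Suc n) x - polyg n x)"
  proof (rule summable_comparison_test')
    show "summable (\<lambda>n. \<theta> * ratio ^ n)"
      using ratio_bounds by (intro summable_mult summable_geometric) auto
  qed (rule polyg_step)
  then have "convergent (\<lambda>n. \<Sum>k<n. polyg (Suc k) x - polyg k x)"
    using summable_iff_convergent by blast
  then have "convergent (\<lambda>n. polyg n x - polyg 0 x)"
    by (simp add: sum_lessThan_telescope[of "\<lambda>n. polyg n x"])
  then have "convergent (\<lambda>n. polyg n x)"
    using convergent_add[OF _ convergent_const[of "polyg 0 x"]] by fastforce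
  then show ?thesis unfolding curve_def by (simp add: convergent_LIMSEQ_iff)
qed

lemma curve_polyg: "cmod (curve x - polyg n x) \<le> 4 * \<theta> * ratio ^ n"
proof (rule tendsto_upperbound)
  show "(\<lambda>m. cmod (polyg (n + m) x - polyg n x)) \<longlonglongrightarrow> cmod (curve x - polyg n x)"
    using LIMSEQ_ignore_initial_segment[OF polyg_tendsto, of n x]
    by (intro tendsto_intros) (simp add: add.commute)
  have "cmod (polyg (n + m) x - polyg n x) \<le> 4 * \<theta> * ratio ^ n" for m
  proof -
    have "4 * \<theta> * ratio ^ n * (1 - ratio ^ m) \<le> 4 * \<theta> * ratio ^ n * 1"
      using ratio_bounds theta_pos by (intro mult_left_mono) auto
    then show ?thesis using polyg_tail[of n m x] by linarith
  qed
  then show "\<forall>\<^sub>F m in sequentially. cmod (polyg (n + m) x - polyg n x) \<le> 4 * \<theta> * ratio ^ n"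
    by simp
qed simp

text \<open>A parameter interval of length \<open>1 / 2 ^ n\<close> meets at most two adjacent
  level-\<open>n\<close> segments, nearly parallel by \<open>norm_seg_adjacent\<close>. The 12 is 4
  for that bend plus 4 at each end for passing from polygon to curve.\<close>

lemma curve_almost_affine:
  assumes "u \<le> x" "x \<le> u + 1 / 2 ^ n"
  shows "cmod (curve x - curve u - of_real (2 ^ n * (x - u)) * seg n \<lfloor>2 ^ n * u\<rfloor>)
    \<le> 12 * \<theta> * ratio ^ n"
proof -
  define k where "k = \<lfloor>2 ^ n * u\<rfloor>"
  have le: "2 ^ n * u \<le> 2 ^ n * x" "2 ^ n * x \<le> 2 ^ n * u + 1"
    using assms by (auto simp: field_simps)
  have "cmod (polyg n x - polyg n u - of_real (2 ^ n * (x - u)) * seg n k) \<le> 4 * \<theta> * ratio ^ n"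
  proof (cases "\<lfloor>2 ^ n * x\<rfloor> = k")
    case True
    then have "polyg n x - polyg n u - of_real (2 ^ n * (x - u)) * seg n k = 0"
      unfolding polyg_def k_def[symmetric] using True k_def by (simp add: frac_def left_diff_distrib right_diff_distrib)
    then show ?thesis using theta_pos ratio_bounds by simp
  next
    case False
    then have fl: "\<lfloor>2 ^ n * x\<rfloor> = k + 1" using le unfolding k_def by linarith
    have "2 ^ n * (x - u) = 1 + frac (2 ^ n * x) - frac (2 ^ n * u)"
      by (simp add: frac_def fl right_diff_distrib flip: k_def)
    then have "polyg n x - polyg n u - of_real (2 ^ n * (x - u)) * seg n k =
        of_real (frac (2 ^ n * x)) * (seg n (k + 1) - seg n k)"
      unfolding polyg_def fl k_def[symmetric] vertex_succ by (simp only: of_real_diff of_real_add)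
        (simp add: algebra_simps)
    then have "cmod (polyg n x - polyg n u - of_real (2 ^ n * (x - u)) * seg n k) =
        frac (2 ^ n * x) * cmod (seg n (k + 1) - seg n k)"
      by (simp add: norm_mult)
    also have "\<dots> \<le> 1 * (4 * \<theta> * ratio ^ n)"
      using norm_seg_adjacent by (intro mult_mono) (auto simp: frac_lt_1 less_imp_le)
    finally show ?thesis by simp
  qed
  moreover have "cmod (curve x - curve u - of_real (2 ^ n * (x - u)) * seg n k) \<le>
      cmod (curve x - polyg n x) + cmod (curve u - polyg n u) +
      cmod (polyg n x - polyg n u - of_real (2 ^ n * (x - u)) * seg n k)"
  proof -
    have eq: "curve x - curve u - of_real (2 ^ n * (x - u)) * seg n k =
      (curve x - polyg n x) - (curve u - polyg n u)
        + (polyg n x - polyg n u - of_real (2 ^ n * (x - u)) * seg n k)" by simp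
    show ?thesis
      unfolding eq by (intro norm_triangle_mono norm_triangle_ineq4 order_refl)
  qed
  ultimately show ?thesis
    using curve_polyg[of x n] curve_polyg[of u n] unfolding k_def[symmetric] by linarith
qed

lemma curve_upper:
  assumes "0 \<le> x" "x \<le> 1 / 2 ^ n"
  shows "cmod (curve x - curve 0) \<le> 2 * ratio ^ n"
proof -
  have "cmod (curve x - curve 0) \<le> cmod (of_real (2 ^ n * x) * seg n 0) + 12 * \<theta> * ratio ^ n"
    using curve_almost_affine[of 0 x n] assms
      norm_triangle_sub[of "curve x - curve 0" "of_real (2 ^ n * x) * seg n 0"] by simp
  also have "cmod (of_real (2 ^ n * x) * seg n 0) = (2 ^ n * x) * ratio ^ n"
    using assms by (simp add: norm_mult norm_seg norm_power)
  also have "\<dots> \<le> 1 * ratio ^ n"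
    using assms ratio_bounds by (intro mult_right_mono) (auto simp: field_simps)
  also have "12 * \<theta> * ratio ^ n \<le> 1 * ratio ^ n"
    using theta_le ratio_bounds by (intro mult_right_mono) auto
  finally show ?thesis by simp
qed

section \<open>The parameter as a Hoelder function of the point\<close>

definition expo :: real where "expo = ln 2 / ln (1 / ratio)"

lemma expo_gt_1: "1 < expo"
proof -
  have "ln (1 / ratio) < ln 2" "0 < ln (1 / ratio)"
    using ratio_bounds by (auto simp: field_simps)
  then show ?thesis by (simp add: expo_def)
qed

lemma power_powr_commute:
  fixes x :: real
  assumes "0 < x"
  shows "(x ^ n) powr a = (x powr a) ^ n"
  using assms by (induction n) (simp_all add: powr_mult)

text \<open>\<open>expo\<close> is the similarity dimension, the solution \<open>s\<close> of
  \<open>2 * ratio powr s = 1\<close>; it converts the length of a level-\<open>n\<close> segment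
  into the length of its parameter interval.\<close>

lemma ratio_powr_expo: "(ratio ^ n) powr expo = 1 / 2 ^ n"
proof -
  have "ln ratio \<noteq> 0" using ratio_bounds by auto
  then have "expo * ln ratio = - ln 2" using ratio_bounds by (simp add: expo_def ln_div)
  then have "ratio powr expo = 1 / 2"
    using ratio_bounds by (simp add: powr_def exp_minus field_simps)
  then show ?thesis
    using ratio_bounds(3) by (simp only: power_powr_commute power_one_over)
qed

text \<open>At the dyadic scale \<open>n\<close> of \<open>x - y\<close> the affine model has length
  at least half of \<open>ratio ^ n\<close>, which dominates its error.\<close>

lemma curve_hoelder:
  assumes "0 < x - y" "x - y \<le> 1"
  shows "x - y \<le> 4 powr expo * cmod (curve x - curve y) powr expo"
proof -
  obtain n where n: "1 / 2 ^ Suc n < x - y" "x - y \<le> 1 / 2 ^ n"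
  proof -
    define P where "P = (\<lambda>n. x - y > 1 / 2 ^ n)"
    obtain m where "P m" unfolding P_def
      using real_arch_pow_inv[OF assms(1), of "1/2"] by (auto simp: power_divide)
    moreover have "\<not> P 0" using assms by (simp add: P_def)
    ultimately obtain n where "\<not> P n" "P (Suc n)" using nat_last_before_failure[of "\<lambda>n. \<not> P n" m] by auto
    then show ?thesis using that by (auto simp: P_def not_less)
  qed
  let ?v = "of_real (2 ^ n * (x - y)) * seg n \<lfloor>2 ^ n * y\<rfloor>"
  have "cmod ?v = 2 ^ n * (x - y) * ratio ^ n"
    using assms ratio_bounds by (simp only: norm_mult norm_seg norm_of_real) simp
  also have "\<dots> \<ge> 1 / 2 * ratio ^ n"
    using n ratio_bounds by (intro mult_right_mono) (auto simp: field_simps)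
  finally have "1 / 2 * ratio ^ n \<le> cmod ?v" .
  moreover have "12 * \<theta> * ratio ^ n \<le> 1 / 4 * ratio ^ n"
    using theta_le ratio_bounds by (intro mult_right_mono) auto
  moreover have "cmod ?v \<le> cmod (curve x - curve y) + cmod (curve x - curve y - ?v)"
    using norm_triangle_ineq4[of "curve x - curve y" "curve x - curve y - ?v"] by simp
  moreover note curve_almost_affine[of y x n]
  \<comment> \<open>Half a segment minus an error of at most a quarter leaves a quarter, hence the
    constant 4.\<close>
  ultimately have "ratio ^ n \<le> 4 * cmod (curve x - curve y)" using n assms by auto
  then have "(ratio ^ n) powr expo \<le> (4 * cmod (curve x - curve y)) powr expo"
    using expo_gt_1 ratio_bounds by (intro powr_mono2) auto
  then show ?thesis using n by (simp add: ratio_powr_expo powr_mult)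
qed

text \<open>
  A ball of radius \<open>\<rho>\<close> meets the curve only at parameters within some dyadic distance of \<open>y\<close>; for the
  smallest such distance the chord is comparable to \<open>\<rho>\<close>, so the affine error is \<open>O(\<theta>\<rho>)\<close>.
\<close>
lemma curve_flat:
  assumes y: "y \<in> {0..1/2}" and \<rho>: "\<rho> > 0"
  shows "\<exists>v. v \<noteq> 0 \<and> (\<forall>t\<in>{0..1/2}. cmod (curve t - curve y) < \<rho> \<longrightarrow>
    (\<exists>r. cmod (curve t - (curve y + of_real r * v)) \<le> 192 * \<theta> * \<rho>))"
proof -
  \<comment> \<open>The half-width \<open>1 / 2 ^ Suc n\<close> makes the interval centred at
    \<open>y\<close> have length \<open>1 / 2 ^ n\<close>, as in \<open>curve_almost_affine\<close>.
    \<open>Q 0\<close> holds because the parameters range over an interval of length 1/2.\<close>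
  define Q where "Q = (\<lambda>n. \<forall>t\<in>{0..1/2}. cmod (curve t - curve y) < \<rho> \<longrightarrow> \<bar>t - y\<bar> \<le> 1 / 2 ^ Suc n)"
  show ?thesis
  proof (cases "\<forall>n. Q n")
    case True
    have *: "t = y" if t: "t \<in> {0..1/2}" "cmod (curve t - curve y) < \<rho>" for t
    proof (rule ccontr)
      assume "t \<noteq> y"
      then obtain n where "(1/2) ^ n < \<bar>t - y\<bar>"
        using real_arch_pow_inv[of "\<bar>t - y\<bar>" "1/2"] by auto
      moreover have "(1/2::real) ^ Suc n \<le> (1/2) ^ n" by simp
      moreover have "\<bar>t - y\<bar> \<le> (1 / 2) ^ Suc n" using True t by (auto simp: Q_def power_divide)
      ultimately show False by linarith
    qed
    show ?thesis
    \<comment> \<open>Only \<open>y\<close> itself is left in the ball, so any direction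
      serves.\<close>
    proof (intro exI[of _ "1 :: complex"] conjI ballI impI)
      fix t assume "t \<in> {0..1/2}" "cmod (curve t - curve y) < \<rho>"
      then have "t = y" by (rule *)
      then show "\<exists>r. cmod (curve t - (curve y + of_real r * 1)) \<le> 192 * \<theta> * \<rho>"
        using theta_pos \<rho> by (intro exI[of _ 0]) simp
    qed simp
  next
    case False
    then obtain m where "\<not> Q m" by blast
    have "Q 0" using y by (auto simp: Q_def abs_le_iff)
    from nat_last_before_failure[of Q, OF this \<open>\<not> Q m\<close>]
    obtain n where Q: "Q n" "\<not> Q (Suc n)" by blast
    \<comment> \<open>\<open>curve_almost_affine\<close> is one-sided, so it is applied from the
      left end of the interval centred at \<open>y\<close>. Comparing both \<open>t\<close> and
      \<open>y\<close> with \<open>u\<close> doubles 12 to 24.\<close>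
    define u where "u = y - 1 / 2 ^ Suc n"
    define v where "v = seg n \<lfloor>2 ^ n * u\<rfloor>"
    have nv: "cmod v = ratio ^ n" by (simp add: v_def norm_seg)
    have aff: "cmod (curve t - (curve y + of_real (2 ^ n * (t - y)) * v)) \<le> 24 * \<theta> * ratio ^ n"
      if "\<bar>t - y\<bar> \<le> 1 / 2 ^ Suc n" for t
    proof -
      have eq: "curve t - (curve y + of_real (2 ^ n * (t - y)) * v) =
        (curve t - curve u - of_real (2 ^ n * (t - u)) * v) -
        (curve y - curve u - of_real (2 ^ n * (y - u)) * v)"
        by (simp add: algebra_simps)
      have "cmod (curve t - curve u - of_real (2 ^ n * (t - u)) * v) \<le> 12 * \<theta> * ratio ^ n"
        unfolding v_def using that by (intro curve_almost_affine) (auto simp: u_def abs_le_iff)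
      moreover have "cmod (curve y - curve u - of_real (2 ^ n * (y - u)) * v) \<le> 12 * \<theta> * ratio ^ n"
        unfolding v_def by (intro curve_almost_affine) (auto simp: u_def)
      moreover have "cmod (curve t - (curve y + of_real (2 ^ n * (t - y)) * v)) \<le>
          cmod (curve t - curve u - of_real (2 ^ n * (t - u)) * v) +
          cmod (curve y - curve u - of_real (2 ^ n * (y - u)) * v)"
        unfolding eq by (rule norm_triangle_ineq4)
      ultimately show ?thesis by linarith
    qed
    obtain t0 where t0: "t0 \<in> {0..1/2}" "cmod (curve t0 - curve y) < \<rho>" "\<bar>t0 - y\<bar> > 1 / 2 ^ Suc (Suc n)"
      using Q(2) by (auto simp: Q_def not_le)
    have "cmod (of_real (2 ^ n * (t0 - y)) * v) = 2 ^ n * \<bar>t0 - y\<bar> * ratio ^ n"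
      by (simp only: norm_mult nv norm_of_real abs_mult) simp
    also have "\<dots> \<ge> 1 / 4 * ratio ^ n"
      using t0 ratio_bounds by (intro mult_right_mono) (auto simp: field_simps)
    finally have "1 / 4 * ratio ^ n \<le> cmod (of_real (2 ^ n * (t0 - y)) * v)" .
    \<comment> \<open>This needs \<theta> at most 1/192, which 1/200 ensures. The chord to
      \<open>t0\<close> then keeps at least 1/4 - 1/8 = 1/8 of \<open>ratio ^ n\<close>, whence
      \<open>ratio ^ n \<le> 8 * \<rho>\<close> and 24 * 8 = 192.\<close>
    moreover have "24 * \<theta> * ratio ^ n \<le> 1 / 8 * ratio ^ n"
      using theta_le ratio_bounds by (intro mult_right_mono) auto
    moreover have "cmod (of_real (2 ^ n * (t0 - y)) * v) \<le> cmod (curve t0 - curve y) +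
        cmod (curve t0 - (curve y + of_real (2 ^ n * (t0 - y)) * v))"
      using norm_triangle_ineq4[of "curve t0 - curve y"
          "curve t0 - (curve y + of_real (2 ^ n * (t0 - y)) * v)"] by simp
    moreover have "\<bar>t0 - y\<bar> \<le> 1 / 2 ^ Suc n" using Q(1) t0 by (auto simp: Q_def)
    note aff[OF this]
    ultimately have rr: "ratio ^ n \<le> 8 * \<rho>" using t0 by linarith
    have small: "24 * \<theta> * ratio ^ n \<le> 24 * \<theta> * (8 * \<rho>)"
      using rr theta_pos by (intro mult_left_mono) auto
    show ?thesis
    proof (intro exI[of _ v] conjI ballI impI)
      show "v \<noteq> 0" using nv ratio_bounds by auto
      fix t assume "t \<in> {0..1/2}" "cmod (curve t - curve y) < \<rho>"
      then have "\<bar>t - y\<bar> \<le> 1 / 2 ^ Suc n" using Q(1) unfolding Q_def by blast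
      from aff[OF this] small
      show "\<exists>r. cmod (curve t - (curve y + of_real r * v)) \<le> 192 * \<theta> * \<rho>"
        by (intro exI[of _ "2 ^ n * (t - y)"]) linarith
    qed
  qed
qed

end

section \<open>Isometric transfer to \<open>real ^ 2\<close>, and lines there\<close>

definition vec_of_complex :: "complex \<Rightarrow> real ^ 2" where
  "vec_of_complex z = (\<chi> i. if i = 1 then Re z else Im z)"

lemma norm_vec_of_complex: "norm (vec_of_complex z) = cmod z"
  by (simp add: norm_vec_def L2_set_def UNIV_2 vec_of_complex_def cmod_def)

lemma vec_of_complex_diff: "vec_of_complex (z - w) = vec_of_complex z - vec_of_complex w"
  by (simp add: vec_of_complex_def vec_eq_iff)

lemma dist_vec_of_complex: "dist (vec_of_complex z) (vec_of_complex w) = cmod (z - w)"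
  by (simp add: dist_norm norm_vec_of_complex flip: vec_of_complex_diff)

lemma vec_of_complex_line:
  "vec_of_complex (z + of_real r * w) = vec_of_complex z + r *\<^sub>R vec_of_complex w"
  by (simp add: vec_of_complex_def vec_eq_iff)

lemma affine_space_of_dim_line:
  fixes p v :: "'a::euclidean_space"
  assumes "v \<noteq> 0"
  shows "affine_space_of_dim 1 (range (\<lambda>r. p + r *\<^sub>R v))"
proof -
  have "affine hull {p, p + v} = range (\<lambda>r. p + r *\<^sub>R v)"
  proof -
    have "affine hull {p, p + v} = (\<lambda>x. p + x) ` span {v}"
      using affine_hull_insert_span_gen[of p "{p + v}"] by simp
    also have "\<dots> = range (\<lambda>r. p + r *\<^sub>R v)" by (auto simp: span_singleton)
    finally show ?thesis .
  qed
  then show ?thesis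
    using aff_dim_2[of p "p + v"] affine_affine_hull[of "{p, p + v}"]
      aff_dim_affine_hull[of "{p, p + v}"] assms
    by (simp add: affine_space_of_dim_def)
qed

theorem corollary5p3:
  fixes \<delta> :: real
  assumes "\<delta> > 0"
  shows "(\<exists>A :: (real ^ 2) set. weak_approx_uniform 1 \<delta> A \<and> \<not> weak_locally_finite_H1 A)
       \<and> (\<exists>A :: (real ^ 2) set. weak_approx_locally_uniform 1 \<delta> A \<and> hausdorff_dim A > 1)
       \<and> (\<exists>A :: (real ^ 2) set. weak_approx_locally_uniform 1 \<delta> A \<and> \<not> weak_locally_finite_H1 A)"
proof -
  \<comment> \<open>192/800 is below 1/2, which turns the bound of \<open>curve_flat\<close> into
    the strict one with \<open>\<delta> / 2\<close>.\<close>
  define \<theta> where "\<theta> = min (1 / 200) (\<delta> / 800)"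
  have "0 < \<theta>" "\<theta> \<le> 1 / 200" "\<theta> \<le> \<delta> / 800" using assms by (auto simp: \<theta>_def)
  interpret koch \<theta> by standard fact+
  define F where "F x = vec_of_complex (curve x)" for x
  define A where "A = F ` {0..1/2}"
  have distF: "dist (F x) (F y) = cmod (curve x - curve y)" for x y
    by (simp add: F_def dist_vec_of_complex)
  have hoelder: "\<bar>x - y\<bar> \<le> 4 powr expo * dist (F x) (F y) powr expo"
    if "\<bar>x - y\<bar> \<le> 1" for x y
    using curve_hoelder[of x y] curve_hoelder[of y x] that
    by (cases x y rule: linorder_cases) (auto simp: distF norm_minus_commute)
  \<comment> \<open>Half of \<delta> is kept in reserve: for centres off \<open>A\<close> the radius
    has to be doubled.\<close>
  have flat: "\<exists>L. affine_space_of_dim 1 L \<and> p \<in> L \<and> ball p \<rho> \<inter> A \<subseteq> open_nbhd L (\<delta> / 2 * \<rho>)"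
    if "p \<in> A" "\<rho> > 0" for p \<rho>
  proof -
    obtain y where y: "y \<in> {0..1/2}" "p = F y" using \<open>p \<in> A\<close> by (auto simp: A_def)
    obtain v where v: "v \<noteq> 0" "\<And>t. t\<in>{0..1/2} \<Longrightarrow> cmod (curve t - curve y) < \<rho> \<Longrightarrow>
      (\<exists>r. cmod (curve t - (curve y + of_real r * v)) \<le> 192 * \<theta> * \<rho>)"
      using curve_flat[OF y(1) \<open>\<rho> > 0\<close>] by blast
    define L where "L = range (\<lambda>r. p + r *\<^sub>R vec_of_complex v)"
    have "vec_of_complex v \<noteq> 0" using v(1) norm_vec_of_complex[of v] by auto
    then have "affine_space_of_dim 1 L" unfolding L_def by (rule affine_space_of_dim_line)
    moreover have "p \<in> L" by (auto simp: L_def intro: image_eqI[of _ _ 0])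
    moreover have "ball p \<rho> \<inter> A \<subseteq> open_nbhd L (\<delta> / 2 * \<rho>)"
    proof
      fix z assume z: "z \<in> ball p \<rho> \<inter> A"
      then obtain t where t: "t \<in> {0..1/2}" "z = F t" by (auto simp: A_def)
      with z y have "cmod (curve t - curve y) < \<rho>" by (simp add: distF norm_minus_commute)
      then obtain r where r: "cmod (curve t - (curve y + of_real r * v)) \<le> 192 * \<theta> * \<rho>"
        using v(2) t(1) by blast
      have "192 * \<theta> * \<rho> < \<delta> / 2 * \<rho>"
        using \<open>\<theta> \<le> \<delta> / 800\<close> assms \<open>\<rho> > 0\<close> by (intro mult_strict_right_mono) auto
      with r have "norm (z - (p + r *\<^sub>R vec_of_complex v)) < \<delta> / 2 * \<rho>"
        unfolding t y F_def vec_of_complex_line[symmetric] vec_of_complex_diff[symmetric]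
          norm_vec_of_complex by simp
      then show "z \<in> open_nbhd L (\<delta> / 2 * \<rho>)" by (auto simp: open_nbhd_def L_def)
    qed
    ultimately show ?thesis by blast
  qed
  have unif: "weak_approx_uniform 1 \<delta> A"
    unfolding weak_approx_uniform_def
  \<comment> \<open>\<open>curve_upper\<close> at level 0 keeps \<open>A\<close> within distance 2
    of \<open>F 0\<close>, and \<open>flat\<close> holds at every scale, so 3 can serve as
    \<open>\<rho>\<^sub>0\<close>.\<close>
  proof (intro exI[of _ "3 :: real"] conjI ballI allI impI)
    have "F x \<in> ball (F 0) 3" if "x \<in> {0..1/2}" for x
      using curve_upper[of x 0] that by (simp add: distF norm_minus_commute)
    then have "A \<subseteq> ball (F 0) 3" unfolding A_def by blast
    then show "\<exists>c. A \<subseteq> ball c 3" ..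
    fix y and \<rho> :: real assume "y \<in> A" "0 < \<rho> \<and> \<rho> \<le> 3"
    then obtain L where L: "affine_space_of_dim 1 L" "y \<in> L"
      "ball y \<rho> \<inter> A \<subseteq> open_nbhd L (\<delta> / 2 * \<rho>)" using flat by blast
    have "\<delta> / 2 * \<rho> \<le> \<delta> * \<rho>" using \<open>0 < \<rho> \<and> \<rho> \<le> 3\<close> assms by simp
    then have "open_nbhd L (\<delta> / 2 * \<rho>) \<subseteq> open_nbhd L (\<delta> * \<rho>)"
      unfolding open_nbhd_def by (blast intro: order_less_le_trans)
    with L show "\<exists>L. affine_space_of_dim 1 L \<and> y \<in> L \<and> ball y \<rho> \<inter> A \<subseteq> open_nbhd L (\<delta> * \<rho>)"
      by blast
  qed simp
  have loc: "weak_approx_locally_uniform 1 \<delta> A"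
    unfolding weak_approx_locally_uniform_def
  proof (intro ballI exI[of _ "1 :: real"] conjI allI impI)
    fix y x :: "real ^ 2" and \<rho> :: real assume "y \<in> A" "0 < \<rho> \<and> \<rho> \<le> 1"
    show "\<exists>L. affine_space_of_dim 1 L \<and> ball x \<rho> \<inter> A \<subseteq> open_nbhd L (\<delta> * \<rho>)"
    proof (cases "ball x \<rho> \<inter> A = {}")
      case True
      \<comment> \<open>With no points to cover any line will do; this one only supplies
        existence.\<close>
      then show ?thesis using flat[OF \<open>y \<in> A\<close>, of 1] by auto
    next
      case False
      then obtain p where p: "p \<in> ball x \<rho>" "p \<in> A" by blast
      then have "ball x \<rho> \<subseteq> ball p (2 * \<rho>)"
        by (auto simp: dist_commute) (metis add_strict_mono dist_commute dist_triangle_lt mult_2)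
      then show ?thesis using flat[OF p(2), of "2 * \<rho>"] \<open>0 < \<rho> \<and> \<rho> \<le> 1\<close> by auto
    qed
  qed simp
  have "ennreal expo \<le> hausdorff_dim A"
    unfolding A_def by (rule hausdorff_dim_ge[where K = "4 powr expo"]) (auto intro!: hoelder)
  then have dim: "hausdorff_dim A > 1"
    using expo_gt_1 by (metis ennreal_1 ennreal_less_iff order_less_le_trans zero_le_one)
  have "\<not> weak_locally_finite_H1 A"
  proof
    assume "weak_locally_finite_H1 A"
    moreover have "F 0 \<in> A" by (simp add: A_def)
    ultimately obtain \<rho> where \<rho>: "\<rho> > 0" "hausdorff_measure 1 (ball (F 0) \<rho> \<inter> A) < \<infinity>"
      unfolding weak_locally_finite_H1_def by blast
    obtain n where n: "ratio ^ n < \<rho> / 2"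
      using real_arch_pow_inv[of "\<rho> / 2" ratio] \<rho> ratio_bounds by auto
    have n': "ratio ^ Suc n < \<rho> / 2"
      using n ratio_bounds power_decreasing[of n "Suc n" ratio] by linarith
    \<comment> \<open>The level \<open>Suc n\<close> rather than \<open>n\<close> ensures
      \<open>c \<le> 1 / 2\<close>, so that the initial arc over \<open>{0..c}\<close> lies in
      \<open>A\<close>.\<close>
    define c :: real where "c = 1 / 2 ^ Suc n"
    have c: "0 < c" "c \<le> 1 / 2" by (auto simp: c_def divide_simps)
    have "F ` {0..c} \<subseteq> ball (F 0) \<rho> \<inter> A"
      using curve_upper[of _ "Suc n"] n' c
      by (fastforce simp: A_def distF norm_minus_commute c_def[symmetric] simp del: power_Suc)
    moreover have "hausdorff_measure 1 (F ` {0..c}) = \<infinity>"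
      using c expo_gt_1
      by (intro hausdorff_measure_infinite[where K = "4 powr expo" and s = expo] hoelder) auto
    ultimately show False using \<rho>(2) hausdorff_measure_mono by (metis leD)
  qed
  with unif loc dim show ?thesis by blast
qed

end
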